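(* Let $h\colon[n]\to[n]$ be a Hessenberg function and let $w\in\mathfrak S_n$ be a generator for $h$. If $w$ contains one of the associated patterns $[2143]_h$, $[1324]_h$, $[1243]_h$, $[2134]_h$, $[1423]_h$, $[2314]_h$, $[2413]_h$, then the graph $\Gamma_{w,h}$ is not regular.
   Context: A Hessenberg function is a nondecreasing $h\colon[n]\to[n]$ with $h(i)\ge i$. For $u\in\mathfrak S_n$ (one-line notation) and $i<j$, $u(i,j)$ is obtained from $u$ by swapping the entries in positions $i$ and $j$. The Bruhat order $\preceq$ is the reflexive–transitive closure of $u\prec u(i,j)$ when $u(i,j)$ has more inversions than $u$; $w_0=n(n-1)\cdots1$, $[w,w_0]=\{u\mid w\preceq u\preceq w_0\}$. A generator for $h$ is a $w$ with $w^{-1}(w(i)+1)\le h(i)$ whenever $w(i)\le n-1$. $\Gamma_h$ is the graph with vertex set $\mathfrak S_n$ and edges $\{u,u(i,j)\}$ for $1\le i<j\le h(i)$; for a generator $w$, $\Gamma_{w,h}$ is the subgraph of $\Gamma_h$ induced on $[w,w_0]$ (this vertex set is the set of torus fixed points of the Hessenberg Schubert variety $\Omega_{w,h}$). A graph is regular if all vertices have the same degree. Associated patterns: $w$ contains $[2143]_h$ if $w(j)<w(i)<w(\ell)<w(k)$ for some $i<j<k<\ell\le h(i)$; $[1324]_h$ if $w(i)<w(k)<w(j)<w(\ell)$ for some $i<j<k<\ell\le h(j)$ with $k\le h(i)$; $[1243]_h$ if $w(i)<w(j)<w(\ell)<w(k)$ for some $i<j<k<\ell\le h(j)$ with $j\le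 h(i)<\ell$; $[2134]_h$ if $w(j)<w(i)<w(k)<w(\ell)$ for some $i<j<k<\ell\le h(k)$ with $k\le h(i)<\ell$; $[1423]_h$ if $w(i)<w(k)<w(\ell)<w(j)$ for some $i<j<k<\ell\le h(j)$ with $k\le h(i)<\ell$; $[2314]_h$ if $w(k)<w(i)<w(j)<w(\ell)$ for some $i<j<k<\ell\le h(j)$ with $k\le h(i)<\ell$; $[2413]_h$ if $w(k)<w(i)<w(\ell)<w(j)$ for some $i<j\le h(i)<k\le h(j)<\ell\le h(k)$. *)

theory Defs
  imports "HOL-Combinatorics.Permutations" "Graph_Theory.Digraph_Component"
begin

text \<open>
  The symmetric group \<open>S\<^sub>n\<close> is \<open>{u. u permutes {1..n}}\<close>; the one-line notation of \<open>u\<close>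
  is \<open>u 1, \<dots>, u n\<close>.
\<close>

definition hessenberg_function :: "nat \<Rightarrow> (nat \<Rightarrow> nat) \<Rightarrow> bool" where
  "hessenberg_function n h \<longleftrightarrow>
     h ` {1..n} \<subseteq> {1..n} \<and> mono_on {1..n} h \<and> (\<forall>i\<in>{1..n}. i \<le> h i)"

definition swap_positions :: "(nat \<Rightarrow> nat) \<Rightarrow> nat \<Rightarrow> nat \<Rightarrow> nat \<Rightarrow> nat" where
  "swap_positions u i j = u \<circ> transpose i j"

definition inversions :: "nat \<Rightarrow> (nat \<Rightarrow> nat) \<Rightarrow> (nat \<times> nat) set" where
  "inversions n u = {(i, j). 1 \<le> i \<and> i < j \<and> j \<le> n \<and> u j < u i}"

definition bruhat_step :: "nat \<Rightarrow> (nat \<Rightarrow> nat) \<Rightarrow> (nat \<Rightarrow> nat) \<Rightarrow> bool" where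
  "bruhat_step n u v \<longleftrightarrow> u permutes {1..n} \<and>
     (\<exists>i j. 1 \<le> i \<and> i < j \<and> j \<le> n \<and> v = swap_positions u i j \<and>
        card (inversions n u) < card (inversions n v))"

definition bruhat_le :: "nat \<Rightarrow> (nat \<Rightarrow> nat) \<Rightarrow> (nat \<Rightarrow> nat) \<Rightarrow> bool" where
  "bruhat_le n = (bruhat_step n)\<^sup>*\<^sup>*"

definition longest_perm :: "nat \<Rightarrow> nat \<Rightarrow> nat" where
  "longest_perm n i = (if i \<in> {1..n} then n + 1 - i else i)"

definition bruhat_interval :: "nat \<Rightarrow> (nat \<Rightarrow> nat) \<Rightarrow> (nat \<Rightarrow> nat) \<Rightarrow> (nat \<Rightarrow> nat) set" where
  "bruhat_interval n v w =
     {u. u permutes {1..n} \<and> bruhat_le n v u \<and> bruhat_le n u w}"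

definition hessenberg_generator :: "nat \<Rightarrow> (nat \<Rightarrow> nat) \<Rightarrow> (nat \<Rightarrow> nat) \<Rightarrow> bool" where
  "hessenberg_generator n h w \<longleftrightarrow> w permutes {1..n} \<and>
     (\<forall>i\<in>{1..n}. w i \<le> n - 1 \<longrightarrow> inv w (w i + 1) \<le> h i)"

text \<open>
  As usual in the graph library, an undirected simple graph is a symmetric loop-free
  digraph: the edge \<open>{u, v}\<close> is the pair of arcs \<open>(u, v)\<close>, \<open>(v, u)\<close>. Swapping two positions
  is an involution, so the arc set below is symmetric (see \<open>pair_graph_hessenberg_graph\<close>).
\<close>

definition hessenberg_graph :: "nat \<Rightarrow> (nat \<Rightarrow> nat) \<Rightarrow> (nat \<Rightarrow> nat) pair_pre_digraph" where
  "hessenberg_graph n h =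
     \<lparr> pverts = {u. u permutes {1..n}},
       parcs = {(u, swap_positions u i j) | u i j.
                  u permutes {1..n} \<and> 1 \<le> i \<and> i < j \<and> j \<le> n \<and> j \<le> h i} \<rparr>"

definition hessenberg_schubert_graph ::
  "nat \<Rightarrow> (nat \<Rightarrow> nat) \<Rightarrow> (nat \<Rightarrow> nat) \<Rightarrow>
     (nat \<Rightarrow> nat, (nat \<Rightarrow> nat) \<times> (nat \<Rightarrow> nat)) pre_digraph" where
  "hessenberg_schubert_graph n w h =
     with_proj (hessenberg_graph n h) \<restriction> bruhat_interval n w (longest_perm n)"

text \<open>In a symmetric digraph the out-degree of a vertex is its degree in the undirected graph.\<close>

definition regular_graph :: "('a, 'b) pre_digraph \<Rightarrow> bool" where
  "regular_graph G \<longleftrightarrow> (\<exists>d. \<forall>v\<in>verts G. out_degree G v = d)"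

definition contains_2143 :: "nat \<Rightarrow> (nat \<Rightarrow> nat) \<Rightarrow> (nat \<Rightarrow> nat) \<Rightarrow> bool" where
  "contains_2143 n h w \<longleftrightarrow>
     (\<exists>i j k l. 1 \<le> i \<and> i < j \<and> j < k \<and> k < l \<and> l \<le> n \<and> l \<le> h i \<and>
        w j < w i \<and> w i < w l \<and> w l < w k)"

definition contains_1324 :: "nat \<Rightarrow> (nat \<Rightarrow> nat) \<Rightarrow> (nat \<Rightarrow> nat) \<Rightarrow> bool" where
  "contains_1324 n h w \<longleftrightarrow>
     (\<exists>i j k l. 1 \<le> i \<and> i < j \<and> j < k \<and> k < l \<and> l \<le> n \<and> l \<le> h j \<and> k \<le> h i \<and>
        w i < w k \<and> w k < w j \<and> w j < w l)"

definition contains_1243 :: "nat \<Rightarrow> (nat \<Rightarrow> nat) \<Rightarrow> (nat \<Rightarrow> nat) \<Rightarrow> bool" where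
  "contains_1243 n h w \<longleftrightarrow>
     (\<exists>i j k l. 1 \<le> i \<and> i < j \<and> j < k \<and> k < l \<and> l \<le> n \<and> l \<le> h j \<and> j \<le> h i \<and> h i < l \<and>
        w i < w j \<and> w j < w l \<and> w l < w k)"

definition contains_2134 :: "nat \<Rightarrow> (nat \<Rightarrow> nat) \<Rightarrow> (nat \<Rightarrow> nat) \<Rightarrow> bool" where
  "contains_2134 n h w \<longleftrightarrow>
     (\<exists>i j k l. 1 \<le> i \<and> i < j \<and> j < k \<and> k < l \<and> l \<le> n \<and> l \<le> h k \<and> k \<le> h i \<and> h i < l \<and>
        w j < w i \<and> w i < w k \<and> w k < w l)"

definition contains_1423 :: "nat \<Rightarrow> (nat \<Rightarrow> nat) \<Rightarrow> (nat \<Rightarrow> nat) \<Rightarrow> bool" where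
  "contains_1423 n h w \<longleftrightarrow>
     (\<exists>i j k l. 1 \<le> i \<and> i < j \<and> j < k \<and> k < l \<and> l \<le> n \<and> l \<le> h j \<and> k \<le> h i \<and> h i < l \<and>
        w i < w k \<and> w k < w l \<and> w l < w j)"

definition contains_2314 :: "nat \<Rightarrow> (nat \<Rightarrow> nat) \<Rightarrow> (nat \<Rightarrow> nat) \<Rightarrow> bool" where
  "contains_2314 n h w \<longleftrightarrow>
     (\<exists>i j k l. 1 \<le> i \<and> i < j \<and> j < k \<and> k < l \<and> l \<le> n \<and> l \<le> h j \<and> k \<le> h i \<and> h i < l \<and>
        w k < w i \<and> w i < w j \<and> w j < w l)"

definition contains_2413 :: "nat \<Rightarrow> (nat \<Rightarrow> nat) \<Rightarrow> (nat \<Rightarrow> nat) \<Rightarrow> bool" where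
  "contains_2413 n h w \<longleftrightarrow>
     (\<exists>i j k l. 1 \<le> i \<and> i < j \<and> j \<le> h i \<and> h i < k \<and> k \<le> h j \<and> h j < l \<and> l \<le> n \<and> l \<le> h k \<and>
        w k < w i \<and> w i < w l \<and> w l < w j)"

lemma pair_graph_hessenberg_graph: "pair_graph (hessenberg_graph n h)"
proof -
  let ?G = "hessenberg_graph n h"
  have perm: "swap_positions u i j permutes {1..n}"
    if "u permutes {1..n}" "1 \<le> i" "i < j" "j \<le> n" for u i j
    using that unfolding swap_positions_def
    by (intro permutes_compose permutes_swap_id) auto
  have arcs: "parcs ?G \<subseteq> pverts ?G \<times> pverts ?G"
    using perm by (auto simp: hessenberg_graph_def)
  have fin: "finite (pverts ?G)"
    by (simp add: hessenberg_graph_def finite_permutations)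
  have ne: "swap_positions u i j \<noteq> u" if "u permutes {1..n}" "i < j" for u i j
  proof
    assume "swap_positions u i j = u"
    then have "u j = u i"
      by (metis comp_apply swap_positions_def transpose_apply_first)
    with permutes_inj[OF that(1)] that(2) show False
      by (auto dest: injD)
  qed
  have invol: "swap_positions (swap_positions u i j) i j = u" for u i j
    by (simp add: swap_positions_def comp_assoc)
  show ?thesis
  proof
    show "fst e \<in> pverts ?G" "snd e \<in> pverts ?G" if "e \<in> parcs ?G" for e
      using that arcs by auto
    show "finite (pverts ?G)" by (rule fin)
    show "finite (parcs ?G)"
      using arcs fin by (meson finite_SigmaI finite_subset)
    show "fst e \<noteq> snd e" if "e \<in> parcs ?G" for e
      using that ne by (fastforce simp: hessenberg_graph_def)
    show "symmetric (with_proj ?G)"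
      unfolding symmetric_def sym_def with_proj_simps
    proof (intro allI impI)
      fix u v assume "(u, v) \<in> parcs ?G"
      then obtain i j where ij: "u permutes {1..n}" "1 \<le> i" "i < j" "j \<le> n" "j \<le> h i"
        and v: "v = swap_positions u i j"
        by (auto simp: hessenberg_graph_def)
      have "u = swap_positions v i j" by (simp add: v invol)
      moreover have "v permutes {1..n}" using perm ij v by simp
      ultimately show "(v, u) \<in> parcs ?G"
        using ij by (auto simp: hessenberg_graph_def)
    qed
  qed
qed

end

theory Submission
  imports Defs
begin

text \<open>
  The neighbours of \<open>v\<close> in the graph are the swaps \<open>v(x,y)\<close> with \<open>y \<le> h x\<close> that still lie above
  \<open>w\<close>; for \<open>v = w\<close> these are the swaps of non-inversions. Fix a set \<open>I\<close> of positions and go up from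
  \<open>w\<close> by swaps of positions in \<open>I\<close>. Then the number of neighbours \<open>v(c,x)\<close> with \<open>x \<in> I\<close>
  never drops for a fixed \<open>c \<notin> I\<close>, nor does the number of neighbours obtained from two positions
  outside \<open>I\<close>. Hence it suffices to find, for each pattern, a
  permutation \<open>u\<close> of the entries in \<open>I\<close> with more neighbours inside \<open>I\<close> than \<open>w\<close> has.
  Three positions suffice for four of the patterns: 1243 and 1423 contain 132 on \<open>a < b < c\<close> with
  \<open>h a < c \<le> h b\<close>, where \<open>u = 312\<close> works, and 2134 and 2314 contain 213 with \<open>b \<le> h a < c\<close>,
  where \<open>u = 231\<close> works. For 1324 take \<open>u = 3412\<close>; for 2143 and 2413 take \<open>u = 4231\<close>.
\<close>

section \<open>Swapping two positions, and its effect on inversions\<close>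

lemma swap_positions_apply:
  "swap_positions u i j x = (if x = i then u j else if x = j then u i else u x)"
  by (auto simp: swap_positions_def transpose_def)

lemma swap_positions_commute: "swap_positions u i j = swap_positions u j i"
  by (simp add: swap_positions_def transpose_commute)

lemma swap_positions_twice: "swap_positions (swap_positions u i j) i j = u"
  by (simp add: swap_positions_def comp_assoc)

lemma swap_positions_permutes:
  assumes "u permutes A" "i \<in> A" "j \<in> A"
  shows "swap_positions u i j permutes A"
  using assms unfolding swap_positions_def by (intro permutes_compose permutes_swap_id)

lemma swap_positions_inject:
  assumes "inj u" "i < j" "i' < j'" "swap_positions u i j = swap_positions u i' j'"
  shows "i = i' \<and> j = j'"
proof -
  have eq: "transpose i j x = transpose i' j' x" for x
    using assms(1) fun_cong[OF assms(4), of x] by (auto simp: swap_positions_def dest: injD)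
  show ?thesis
    using eq[of i] eq[of j] assms(2,3) by (auto simp: transpose_def split: if_splits)
qed

lemma finite_inversions: "finite (inversions n u)"
  by (rule finite_subset[of _ "{1..n} \<times> {1..n}"]) (auto simp: inversions_def)

text \<open>The map \<open>f\<close> applies the transposition to both positions of an inversion if
  this keeps them in order, and leaves the inversion alone otherwise. It is injective and misses the
  new inversion \<open>(i, j)\<close>.\<close>

lemma card_inversions_less_swap:
  assumes ij: "1 \<le> i" "i < j" "j \<le> n" and less: "u i < u j"
  shows "card (inversions n u) < card (inversions n (swap_positions u i j))"
proof -
  let ?t = "transpose i j" and ?v = "swap_positions u i j"
  define f where "f = (\<lambda>(x, y). if ?t x < ?t y then (?t x, ?t y) else (x, y))"
  have tt: "?t x \<noteq> ?t y" if "x \<noteq> y" for x y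
    using that by (metis transpose_involutory)
  have inj: "inj_on f (inversions n u)"
  proof (rule inj_onI, clarify)
    fix x y x' y' assume xy: "(x, y) \<in> inversions n u" "(x', y') \<in> inversions n u"
      and eq: "f (x, y) = f (x', y')"
    have "x < y" "x' < y'" using xy by (auto simp: inversions_def)
    with eq show "x = x' \<and> y = y'"
      unfolding f_def by (auto split: if_splits dest: arg_cong[of _ _ ?t])
  qed
  have sub: "f (x, y) \<in> inversions n ?v - {(i, j)}" if "(x, y) \<in> inversions n u" for x y
  proof (cases "?t x < ?t y")
    case True
    have "?t x \<in> {1..n}" "?t y \<in> {1..n}"
      using that ij by (auto simp: inversions_def transpose_def)
    moreover have "(?t x, ?t y) \<noteq> (i, j)"
      using that ij by (auto simp: inversions_def transpose_eq_iff)
    ultimately show ?thesis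
      using True that by (auto simp: f_def inversions_def swap_positions_def)
  next
    case False
    \<comment> \<open>For an inversion of \<open>u\<close> the order is reversed only if the other
      position lies between \<open>i\<close> and \<open>j\<close>. Position \<open>i\<close> gets a
      larger entry and \<open>j\<close> a smaller one, so the inversion survives.\<close>
    then have "x = i \<or> y = j"
      using that ij by (auto simp: inversions_def transpose_def split: if_splits)
    with False show ?thesis
      using that ij less
      by (auto simp: f_def inversions_def transpose_def swap_positions_apply split: if_splits)
  qed
  have "(i, j) \<in> inversions n ?v"
    using ij less by (simp add: inversions_def swap_positions_apply)
  then have "card (inversions n ?v - {(i, j)}) < card (inversions n ?v)"
    using finite_inversions by (rule card_Diff1_less[rotated])
  moreover have "card (inversions n u) \<le> card (inversions n ?v - {(i, j)})"
    using inj sub finite_inversions by (intro card_inj_on_le[of f]) fastforce+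
  ultimately show ?thesis by linarith
qed

section \<open>The rank criterion for the Bruhat order\<close>

definition rank :: "(nat \<Rightarrow> nat) \<Rightarrow> nat \<Rightarrow> nat \<Rightarrow> nat" where
  "rank u p q = card {x \<in> {1..p}. q \<le> u x}"

text \<open>Comparison of rank matrices: on permutations of \<open>{1..n}\<close> this is the Bruhat
  order, in a form that is tested without chains.\<close>

definition rank_le :: "(nat \<Rightarrow> nat) \<Rightarrow> (nat \<Rightarrow> nat) \<Rightarrow> bool" (infix \<open>\<sqsubseteq>\<close> 50) where
  "u \<sqsubseteq> v \<longleftrightarrow> (\<forall>p q. rank u p q \<le> rank v p q)"

lemma rank_le_refl: "u \<sqsubseteq> u"
  by (simp add: rank_le_def)

text \<open>For \<open>p < x\<close> neither swapped position is counted and for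
  \<open>y \<le> p\<close> both are. In between only \<open>x\<close> is, and the count gains one
  exactly when \<open>q\<close> separates the two entries.\<close>

lemma rank_swap:
  assumes "1 \<le> x" "x < y" "v x < v y"
  shows "rank (swap_positions v x y) p q =
    rank v p q + of_bool (x \<le> p \<and> p < y \<and> v x < q \<and> q \<le> v y)"
proof -
  let ?v = "swap_positions v x y"
  consider "p < x" | "y \<le> p" | "x \<le> p" "p < y" by linarith
  then show ?thesis
  proof cases
    case 1
    then have "{z \<in> {1..p}. q \<le> ?v z} = {z \<in> {1..p}. q \<le> v z}"
      using assms by (auto simp: swap_positions_apply)
    with 1 show ?thesis by (simp add: rank_def)
  next
    case 2
    have "transpose x y ` {z \<in> {1..p}. q \<le> v z} = {z \<in> {1..p}. q \<le> ?v z}"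
    proof (intro equalityI subsetI)
      fix z assume "z \<in> {z \<in> {1..p}. q \<le> ?v z}"
      then have "transpose x y z \<in> {z \<in> {1..p}. q \<le> v z}"
        using 2 assms by (auto simp: swap_positions_apply transpose_def)
      then have "transpose x y (transpose x y z) \<in> transpose x y ` {z \<in> {1..p}. q \<le> v z}"
        by (rule imageI)
      then show "z \<in> transpose x y ` {z \<in> {1..p}. q \<le> v z}" by simp
    qed (use 2 assms in \<open>auto simp: swap_positions_apply transpose_def split: if_splits\<close>)
    then have "card {z \<in> {1..p}. q \<le> ?v z} = card {z \<in> {1..p}. q \<le> v z}"
      by (metis card_image inj_on_transpose)
    with 2 show ?thesis by (simp add: rank_def)
  next
    case 3
    let ?A = "{z \<in> {1..p}. z \<noteq> x \<and> q \<le> v z}"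
    have "rank g p q = card ?A + of_bool (q \<le> g x)"
      if "\<And>z. z \<in> {1..p} \<Longrightarrow> z \<noteq> x \<Longrightarrow> g z = v z" for g
    proof -
      have "x \<in> {1..p}" using assms 3 by simp
      then have "{z \<in> {1..p}. q \<le> g z} =
          (if q \<le> g x then insert x {z \<in> {1..p}. z \<noteq> x \<and> q \<le> g z}
           else {z \<in> {1..p}. z \<noteq> x \<and> q \<le> g z})"
        by auto
      also have "{z \<in> {1..p}. z \<noteq> x \<and> q \<le> g z} = ?A" using that by auto
      finally have "rank g p q = card (if q \<le> g x then insert x ?A else ?A)"
        unfolding rank_def by (rule arg_cong)
      then show ?thesis by simp
    qed
    from this[of v] this[of ?v] show ?thesis
      using 3 assms by (auto simp: swap_positions_apply)
  qed
qed

lemma rank_le_swap: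
  assumes "u \<sqsubseteq> v" "1 \<le> x" "x < y" "v x < v y" "v' = swap_positions v x y"
  shows "u \<sqsubseteq> v'"
  using assms rank_swap[of x y v] unfolding rank_le_def by (simp add: le_add1 trans_le_add1)

lemma not_rank_le_swap:
  assumes "1 \<le> x" "x < y" "w y < w x"
  shows "\<not> w \<sqsubseteq> swap_positions w x y"
proof
  assume "w \<sqsubseteq> swap_positions w x y"
  \<comment> \<open>At \<open>p = x\<close> and \<open>q = w x\<close>, undoing the swap raises the
    rank by one.\<close>
  then have "rank w x (w x) \<le> rank (swap_positions w x y) x (w x)"
    by (simp add: rank_le_def)
  then show False
    using rank_swap[of x y "swap_positions w x y" x "w x"] assms
    by (simp add: swap_positions_twice) (simp add: swap_positions_apply)
qed

text \<open>The two swaps change the rank function on disjoint ranges of \<open>p\<close>.\<close>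

lemma rank_le_meet:
  assumes "1 \<le> a" "a < b" "b < c" "z a < z b" "z b < z c"
    and "w \<sqsubseteq> swap_positions z a b" "w \<sqsubseteq> swap_positions z b c"
  shows "w \<sqsubseteq> z"
  unfolding rank_le_def
proof (intro allI)
  fix p q
  show "rank w p q \<le> rank z p q"
    using assms(6,7)[unfolded rank_le_def, rule_format, of p q] assms(1-5)
      rank_swap[of a b z p q] rank_swap[of b c z p q]
    by (cases "p < b") auto
qed

section \<open>The largest element, and the comparison of the two orders\<close>

lemma longest_perm_permutes: "longest_perm n permutes {1..n}"
  by (rule bij_imp_permutes)
    (auto intro!: bij_betw_byWitness[of _ "\<lambda>i. n + 1 - i"] simp: longest_perm_def)

lemma rank_eq_card_image:
  assumes "inj u"
  shows "rank u p q = card {y \<in> u ` {1..p}. q \<le> y}"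
proof -
  have "{y \<in> u ` {1..p}. q \<le> y} = u ` {x \<in> {1..p}. q \<le> u x}" by auto
  then show ?thesis
    using assms unfolding rank_def by (simp add: card_image inj_on_subset)
qed

text \<open>For \<open>p \<le> n\<close> the rank is at most \<open>p\<close> and at most
  \<open>n + 1 - q\<close>; the longest permutation puts the largest entries first and attains the
  smaller bound. For \<open>p > n\<close> all ranks agree, since positions beyond \<open>n\<close>
  are fixed.\<close>

lemma rank_le_longest:
  assumes "u permutes {1..n}"
  shows "u \<sqsubseteq> longest_perm n"
  unfolding rank_le_def
proof (intro allI)
  fix p q
  let ?A = "{x \<in> {1..p}. q \<le> u x}" and ?B = "{x \<in> {1..p}. q \<le> longest_perm n x}"
  show "rank u p q \<le> rank (longest_perm n) p q"
  proof (cases "p \<le> n")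
    case False
    then have "v ` {1..p} = {1..p}" if "v permutes {1..n}" for v
      using permutes_subset[OF that, of "{1..p}"] by (simp add: permutes_image)
    then show ?thesis
      using assms longest_perm_permutes[of n] by (simp only: rank_eq_card_image permutes_inj)
  next
    case True
    show ?thesis
    proof (cases "p \<le> n + 1 - q")
      case le: True
      then have "?A \<subseteq> ?B" using True by (auto simp: longest_perm_def)
      then show ?thesis unfolding rank_def by (intro card_mono) auto
    next
      case False
      have "u ` {1..p} \<subseteq> u ` {1..n}" using True by (intro image_mono) auto
      then have "u ` {1..p} \<subseteq> {1..n}" by (simp only: permutes_image[OF assms])
      then have "rank u p q \<le> card {q..n}"
        unfolding rank_eq_card_image[OF permutes_inj[OF assms]] by (intro card_mono) auto
      moreover have "{1..n + 1 - q} \<subseteq> ?B"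
        using False True by (auto simp: longest_perm_def)
      then have "card {1..n + 1 - q} \<le> rank (longest_perm n) p q"
        unfolding rank_def by (intro card_mono) auto
      ultimately show ?thesis by simp
    qed
  qed
qed

text \<open>Each Bruhat step swaps an ascent, because swapping a descent lowers the number of
  inversions; such swaps only raise ranks.\<close>

lemma bruhat_le_imp_rank_le:
  assumes "bruhat_le n u v"
  shows "u \<sqsubseteq> v"
  using assms unfolding bruhat_le_def
proof induction
  case base
  show ?case by (rule rank_le_refl)
next
  case (step v v')
  from step(2) obtain i j where perm: "v permutes {1..n}"
    and ij: "1 \<le> i" "i < j" "j \<le> n" "v' = swap_positions v i j"
    and card: "card (inversions n v) < card (inversions n v')"
    unfolding bruhat_step_def by blast
  have "v i \<noteq> v j"
    using permutes_inj[OF perm] ij by (auto dest: injD)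
  moreover have "\<not> v j < v i"
  proof
    assume "v j < v i"
    then have "v' i < v' j" using ij by (simp add: swap_positions_apply)
    from card_inversions_less_swap[OF ij(1-3) this] card show False
      by (simp add: ij(4) swap_positions_twice)
  qed
  ultimately have "v i < v j" by linarith
  then show ?case by (rule rank_le_swap[OF step.IH ij(1,2) _ ij(4)])
qed

text \<open>Let \<open>u\<close> and \<open>v\<close> first differ at \<open>a\<close>; then
  \<open>u a < v a\<close>. Swapping \<open>a\<close> with the first later position \<open>b\<close>
  whose entry exceeds \<open>u a\<close> but not \<open>v a\<close> stays below \<open>v\<close> and
  adds inversions. As their number is bounded, this ends at \<open>v\<close>.\<close>

lemma rank_le_imp_bruhat_le:
  assumes "u permutes {1..n}" "v permutes {1..n}" "u \<sqsubseteq> v"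
  shows "bruhat_le n u v"
  using assms
proof (induction "card ({1..n} \<times> {1..n}) - card (inversions n u)" arbitrary: u rule: less_induct)
  case less
  show ?case
  proof (cases "u = v")
    case True
    then show ?thesis by (simp add: bruhat_le_def)
  next
    case False
    define a where "a = (LEAST x. u x \<noteq> v x)"
    have a: "u a \<noteq> v a" unfolding a_def using False LeastI_ex[of "\<lambda>x. u x \<noteq> v x"] by blast
    have below: "u x = v x" if "x < a" for x
      using not_less_Least[of x "\<lambda>x. u x \<noteq> v x"] that unfolding a_def by blast
    have a_in: "a \<in> {1..n}"
      using a permutes_not_in[OF less.prems(1)] permutes_not_in[OF less.prems(2)] by metis
    have ua: "u a < v a"
    proof (rule ccontr)
      assume "\<not> u a < v a"
      \<comment> \<open>Earlier entries agree, and position \<open>a\<close> is counted for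
        \<open>u\<close> only.\<close>
      then have "{x \<in> {1..a}. u a \<le> v x} \<subset> {x \<in> {1..a}. u a \<le> u x}"
      proof (intro psubsetI subsetI)
        fix x assume "x \<in> {x \<in> {1..a}. u a \<le> v x}"
        then show "x \<in> {x \<in> {1..a}. u a \<le> u x}"
          using below[of x] by (cases "x = a") auto
      next
        have "a \<in> {x \<in> {1..a}. u a \<le> u x}" "a \<notin> {x \<in> {1..a}. u a \<le> v x}"
          using a a_in \<open>\<not> u a < v a\<close> by auto
        then show "{x \<in> {1..a}. u a \<le> v x} \<noteq> {x \<in> {1..a}. u a \<le> u x}" by blast
      qed
      then have "rank v a (u a) < rank u a (u a)"
        unfolding rank_def by (intro psubset_card_mono) auto
      with less.prems(3) show False by (simp add: rank_le_def not_le[symmetric])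
    qed
    let ?P = "\<lambda>x. a < x \<and> u a < u x \<and> u x \<le> v a"
    define b where "b = (LEAST x. ?P x)"
    \<comment> \<open>The entry \<open>v a\<close> occurs in \<open>u\<close> after
      \<open>a\<close>, because \<open>v\<close> has it at \<open>a\<close> and agrees with
      \<open>u\<close> before.\<close>
    have ex: "\<exists>x. ?P x"
    proof -
      obtain x where x: "u x = v a" using permutes_surj[OF less.prems(1)] by (metis surj_def)
      have "\<not> x < a"
      proof
        assume "x < a"
        then have "v x = v a" using below x by simp
        then show False using permutes_inj[OF less.prems(2)] \<open>x < a\<close> by (auto dest: injD)
      qed
      moreover have "x \<noteq> a" using a x by auto
      ultimately have "?P x" using ua x by simp
      then show ?thesis by blast
    qed
    have b: "?P b" unfolding b_def using LeastI_ex[OF ex] by blast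
    have between: "\<not> ?P x" if "x < b" for x
      using not_less_Least[of x ?P] that unfolding b_def by blast
    have b_in: "b \<in> {1..n}"
    proof (rule ccontr)
      assume "b \<notin> {1..n}"
      then have "u b = b" using permutes_not_in[OF less.prems(1)] by blast
      moreover have "v a \<in> {1..n}" using a_in permutes_in_image[OF less.prems(2)] by blast
      ultimately show False using b \<open>b \<notin> {1..n}\<close> by auto
    qed
    let ?u = "swap_positions u a b"
    have ab: "1 \<le> a" "a < b" "b \<le> n" "u a < u b" using a_in b b_in by auto
    \<comment> \<open>The swap raises ranks by one on this rectangle, so strictness is needed here.
      Entries above \<open>v a\<close> are compared by hypothesis. Those of \<open>u\<close> from
      \<open>q\<close> to \<open>v a\<close> sit before \<open>a\<close> by the choice of
      \<open>b\<close>, so \<open>v\<close> shares them, and \<open>v\<close> has the entry at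
      \<open>a\<close> in addition.\<close>
    have "rank u p q < rank v p q" if "a \<le> p" "p < b" "u a < q" "q \<le> u b" for p q
    proof -
      let ?m = "Suc (v a)"
      have split: "rank g p q = rank g p ?m + card {x \<in> {1..p}. q \<le> g x \<and> g x < ?m}" for g
      proof -
        have "{x \<in> {1..p}. q \<le> g x} = {x \<in> {1..p}. ?m \<le> g x} \<union> {x \<in> {1..p}. q \<le> g x \<and> g x < ?m}"
          using that b by auto
        then show ?thesis
          unfolding rank_def by (simp only:) (intro card_Un_disjoint, auto)
      qed
      have "{x \<in> {1..p}. q \<le> u x \<and> u x < ?m} \<subset> {x \<in> {1..p}. q \<le> v x \<and> v x < ?m}"
      proof
        show "{x \<in> {1..p}. q \<le> u x \<and> u x < ?m} \<subseteq> {x \<in> {1..p}. q \<le> v x \<and> v x < ?m}"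
        proof
          fix x assume x: "x \<in> {x \<in> {1..p}. q \<le> u x \<and> u x < ?m}"
          then have "x < a" using between[of x] that by (cases "x = a") auto
          with x below show "x \<in> {x \<in> {1..p}. q \<le> v x \<and> v x < ?m}" by auto
        qed
        have "a \<in> {x \<in> {1..p}. q \<le> v x \<and> v x < ?m}" using that ab b by auto
        moreover have "a \<notin> {x \<in> {1..p}. q \<le> u x \<and> u x < ?m}" using that by auto
        ultimately show "{x \<in> {1..p}. q \<le> u x \<and> u x < ?m} \<noteq> {x \<in> {1..p}. q \<le> v x \<and> v x < ?m}"
          by metis
      qed
      then have "card {x \<in> {1..p}. q \<le> u x \<and> u x < ?m} < card {x \<in> {1..p}. q \<le> v x \<and> v x < ?m}"
        by (intro psubset_card_mono) auto
      moreover have "rank u p ?m \<le> rank v p ?m"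
        using less.prems(3) by (simp add: rank_le_def)
      ultimately show ?thesis by (simp add: split)
    qed
    then have le: "?u \<sqsubseteq> v"
      using less.prems(3) rank_swap[OF ab(1,2,4)] unfolding rank_le_def
      by (auto simp: of_bool_def Suc_le_eq)
    have perm: "?u permutes {1..n}"
      using less.prems(1) a_in b_in by (intro swap_positions_permutes)
    have card: "card (inversions n u) < card (inversions n ?u)"
      using ab by (intro card_inversions_less_swap)
    have "card (inversions n ?u) \<le> card ({1..n} \<times> {1..n})"
      by (intro card_mono) (auto simp: inversions_def)
    then have "bruhat_le n ?u v"
      using card perm le less.prems(2) by (intro less.hyps) auto
    moreover have "bruhat_step n u ?u"
      unfolding bruhat_step_def using less.prems(1) ab card by blast
    ultimately show ?thesis
      unfolding bruhat_le_def by (meson converse_rtranclp_into_rtranclp)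
  qed
qed

lemma bruhat_interval_longest:
  assumes "w permutes {1..n}"
  shows "bruhat_interval n w (longest_perm n) = {u. u permutes {1..n} \<and> w \<sqsubseteq> u}"
  using assms
  unfolding bruhat_interval_def
  using bruhat_le_imp_rank_le rank_le_imp_bruhat_le rank_le_longest longest_perm_permutes by blast

section \<open>Degrees along Bruhat chains\<close>

definition hess_pair :: "nat \<Rightarrow> (nat \<Rightarrow> nat) \<Rightarrow> nat \<Rightarrow> nat \<Rightarrow> bool" where
  "hess_pair n h x y \<longleftrightarrow>
     x \<in> {1..n} \<and> y \<in> {1..n} \<and> (x < y \<and> y \<le> h x \<or> y < x \<and> x \<le> h y)"

text \<open>A neighbour is recorded by the swapped pair; for a permutation \<open>v\<close>,
  distinct pairs \<open>x < y\<close> give distinct vertices by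
  \<open>swap_positions_inject\<close>.\<close>

definition neighbour :: "nat \<Rightarrow> (nat \<Rightarrow> nat) \<Rightarrow> (nat \<Rightarrow> nat) \<Rightarrow> (nat \<Rightarrow> nat) \<Rightarrow> nat \<Rightarrow> nat \<Rightarrow> bool"
  where "neighbour n h w v x y \<longleftrightarrow> hess_pair n h x y \<and> w \<sqsubseteq> swap_positions v x y"

lemma hess_pair_commute: "hess_pair n h x y = hess_pair n h y x"
  by (auto simp: hess_pair_def)

lemma neighbour_commute: "neighbour n h w v x y = neighbour n h w v y x"
  by (simp add: neighbour_def hess_pair_commute[of n h x y] swap_positions_commute[of v x y])

lemma neighbour_irrefl: "\<not> neighbour n h w v x x"
  by (simp add: neighbour_def hess_pair_def)

text \<open>Monotonicity gives \<open>y' \<le> y \<le> h x \<le> h x'\<close>, so a neighbour may be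
  traded for one with a nested pair.\<close>

lemma hess_pair_mono:
  assumes "hessenberg_function n h" "hess_pair n h x y" "x \<le> x'" "x' < y'" "y' \<le> y"
  shows "hess_pair n h x' y'"
proof -
  have "h x \<le> h x'"
    using assms unfolding hessenberg_function_def
    by (intro mono_onD[of "{1..n}" h]) (auto simp: hess_pair_def)
  then show ?thesis using assms by (auto simp: hess_pair_def)
qed

lemma neighbour_self:
  assumes "x < y" "w x \<noteq> w y"
  shows "neighbour n h w w x y \<longleftrightarrow> hess_pair n h x y \<and> w x < w y"
proof (cases "hess_pair n h x y")
  case True
  then have "1 \<le> x" by (simp add: hess_pair_def)
  then show ?thesis
    using True assms not_rank_le_swap[of x y w] rank_le_swap[OF rank_le_refl, of x y w]
    unfolding neighbour_def by (metis linorder_neqE_nat)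
qed (simp add: neighbour_def)

text \<open>The two swaps commute, so the result arises from \<open>swap_positions v c d\<close> by
  the upward swap of \<open>a\<close> and \<open>b\<close>.\<close>

lemma neighbour_swap_disjoint:
  assumes "neighbour n h w v c d" "1 \<le> a" "a < b" "v a < v b" "{a, b} \<inter> {c, d} = {}"
  shows "neighbour n h w (swap_positions v a b) c d"
proof -
  have "w \<sqsubseteq> swap_positions (swap_positions v a b) c d"
    by (rule rank_le_swap[of w "swap_positions v c d" a b])
      (use assms in \<open>auto simp: neighbour_def fun_eq_iff swap_positions_apply\<close>)
  then show ?thesis using assms(1) by (simp add: neighbour_def)
qed

text \<open>
  Each neighbour of \<open>v\<close> is matched with a neighbour of \<open>v(a,b)\<close> above it; where the positions change,
  the new pair is the shorter one, so it is allowed because \<open>h\<close> is nondecreasing. This breaks down only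
  if \<open>v\<close> is 231 or 312 on the three positions and both 132 and 213 lie above \<open>w\<close>: then
  \<open>rank_le_meet\<close> puts the neighbour 123 of \<open>v(a,b)\<close> above \<open>w\<close>.
\<close>

lemma neighbour_swap_pair:
  assumes h: "hessenberg_function n h" and wv: "w \<sqsubseteq> v" and inj: "inj v"
    and ab: "a \<in> {1..n}" "b \<in> {1..n}" "a < b" "v a < v b"
    and c: "c \<in> {1..n}" "c \<noteq> a" "c \<noteq> b"
  shows "of_bool (neighbour n h w v c a) + of_bool (neighbour n h w v c b)
    \<le> (of_bool (neighbour n h w (swap_positions v a b) c a) +
       of_bool (neighbour n h w (swap_positions v a b) c b) :: nat)"
proof -
  let ?v = "swap_positions v a b"
  have pos: "1 \<le> a" "1 \<le> b" "1 \<le> c" using ab c by auto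
  have up: "w \<sqsubseteq> z \<Longrightarrow> 1 \<le> x \<Longrightarrow> x < y \<Longrightarrow> z x < z y \<Longrightarrow>
      \<forall>i. z' i = swap_positions z x y i \<Longrightarrow> w \<sqsubseteq> z'" for z x y z'
    by (rule rank_le_swap[of w z x y z']) auto
  note sw = swap_positions_apply
  have wv': "w \<sqsubseteq> ?v" by (rule up[of v a b]) (use wv pos ab in auto)
  have ne: "v c \<noteq> v a" "v c \<noteq> v b" using c inj by (auto dest: injD)
  consider "b < c" | "c < a" | "a < c" "c < b" using c by linarith
  then show ?thesis
  proof cases
    case 1
    have edge: "hess_pair n h c a \<Longrightarrow> hess_pair n h c b"
      using hess_pair_mono[OF h, of a c b c] 1 ab(3)
      by (simp add: hess_pair_commute[of n h c])
    consider "v b < v c" | "v a < v c" "v c < v b" | "v c < v a" using ne by linarith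
    then show ?thesis
    proof cases
      case c: 1
      have "w \<sqsubseteq> swap_positions ?v c a"
        by (rule up[of ?v a c]) (use wv' pos ab c 1 in \<open>auto simp: sw\<close>)
      moreover have "w \<sqsubseteq> swap_positions ?v c b"
        by (rule up[of ?v b c]) (use wv' pos ab c 1 in \<open>auto simp: sw\<close>)
      ultimately show ?thesis by (simp add: neighbour_def)
    next
      case c: 2
      have "w \<sqsubseteq> swap_positions ?v c b"
        by (rule up[of ?v b c]) (use wv' pos ab c 1 in \<open>auto simp: sw\<close>)
      moreover have "w \<sqsubseteq> swap_positions ?v c a" if "w \<sqsubseteq> swap_positions v c b"
        by (rule up[of "swap_positions v c b" a b]) (use that pos ab c 1 in \<open>auto simp: sw\<close>)
      ultimately show ?thesis using edge by (auto simp: neighbour_def)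
    next
      case c: 3
      have "w \<sqsubseteq> swap_positions ?v c b" if "w \<sqsubseteq> swap_positions v c a"
        by (rule up[of "swap_positions v c a" a b]) (use that pos ab c 1 in \<open>auto simp: sw\<close>)
      moreover have "w \<sqsubseteq> swap_positions ?v c b" if "w \<sqsubseteq> swap_positions v c b"
        by (rule up[of "swap_positions v c b" a c]) (use that pos ab c 1 in \<open>auto simp: sw\<close>)
      moreover have "w \<sqsubseteq> swap_positions ?v c a"
        if "w \<sqsubseteq> swap_positions v c a" "w \<sqsubseteq> swap_positions v c b"
      proof (rule rank_le_meet[of a b c])
        have "swap_positions (swap_positions ?v c a) a b = swap_positions v c b"
          "swap_positions (swap_positions ?v c a) b c = swap_positions v c a"
          using 1 ab by (auto simp: fun_eq_iff sw)
        with that show "w \<sqsubseteq> swap_positions (swap_positions ?v c a) a b"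
          "w \<sqsubseteq> swap_positions (swap_positions ?v c a) b c" by simp_all
      qed (use pos ab c 1 in \<open>auto simp: sw\<close>)
      ultimately show ?thesis using edge by (auto simp: neighbour_def)
    qed
  next
    case 2
    have edge: "hess_pair n h c b \<Longrightarrow> hess_pair n h c a"
      using hess_pair_mono[OF h, of c b c a] 2 ab(3) by simp
    consider "v c < v a" | "v a < v c" "v c < v b" | "v b < v c" using ne by linarith
    then show ?thesis
    proof cases
      case c: 1
      have "w \<sqsubseteq> swap_positions ?v c a"
        by (rule up[of ?v c a]) (use wv' pos ab c 2 in \<open>auto simp: sw\<close>)
      moreover have "w \<sqsubseteq> swap_positions ?v c b"
        by (rule up[of ?v c b]) (use wv' pos ab c 2 in \<open>auto simp: sw\<close>)
      ultimately show ?thesis by (simp add: neighbour_def)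
    next
      case c: 2
      have "w \<sqsubseteq> swap_positions ?v c a"
        by (rule up[of ?v c a]) (use wv' pos ab c 2 in \<open>auto simp: sw\<close>)
      moreover have "w \<sqsubseteq> swap_positions ?v c b" if "w \<sqsubseteq> swap_positions v c a"
        by (rule up[of "swap_positions v c a" a b]) (use that pos ab c 2 in \<open>auto simp: sw\<close>)
      ultimately show ?thesis using edge by (auto simp: neighbour_def)
    next
      case c: 3
      have "w \<sqsubseteq> swap_positions ?v c a" if "w \<sqsubseteq> swap_positions v c a"
        by (rule up[of "swap_positions v c a" c b]) (use that pos ab c 2 in \<open>auto simp: sw\<close>)
      moreover have "w \<sqsubseteq> swap_positions ?v c a" if "w \<sqsubseteq> swap_positions v c b"
        by (rule up[of "swap_positions v c b" a b]) (use that pos ab c 2 in \<open>auto simp: sw\<close>)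
      moreover have "w \<sqsubseteq> swap_positions ?v c b"
        if "w \<sqsubseteq> swap_positions v c a" "w \<sqsubseteq> swap_positions v c b"
      proof (rule rank_le_meet[of c a b])
        have "swap_positions (swap_positions ?v c b) c a = swap_positions v c b"
          "swap_positions (swap_positions ?v c b) a b = swap_positions v c a"
          using 2 ab by (auto simp: fun_eq_iff sw)
        with that show "w \<sqsubseteq> swap_positions (swap_positions ?v c b) c a"
          "w \<sqsubseteq> swap_positions (swap_positions ?v c b) a b" by simp_all
      qed (use pos ab c 2 in \<open>auto simp: sw\<close>)
      ultimately show ?thesis using edge by (auto simp: neighbour_def)
    qed
  next
    \<comment> \<open>Neither of the pairs \<open>c, a\<close> and \<open>c, b\<close> contains the
      other, so each neighbour has to survive with its own pair.\<close>
    case 3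
    consider "v c < v a" | "v a < v c" "v c < v b" | "v b < v c" using ne by linarith
    then have "w \<sqsubseteq> swap_positions ?v c a" if "w \<sqsubseteq> swap_positions v c a"
    proof cases
      case c: 1
      show ?thesis
        by (rule up[of "swap_positions v c a" c b]) (use that pos ab c 3 in \<open>auto simp: sw\<close>)
    next
      case c: 2
      show ?thesis
        by (rule up[of "swap_positions v c a" c b]) (use that pos ab c 3 in \<open>auto simp: sw\<close>)
    next
      case c: 3
      show ?thesis
        by (rule up[of ?v a c]) (use wv' pos ab c 3 in \<open>auto simp: sw\<close>)
    qed
    moreover consider "v c < v a" | "v a < v c" "v c < v b" | "v b < v c" using ne by linarith
    then have "w \<sqsubseteq> swap_positions ?v c b" if "w \<sqsubseteq> swap_positions v c b"
    proof cases
      case c: 1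
      show ?thesis
        by (rule up[of ?v c b]) (use wv' pos ab c 3 in \<open>auto simp: sw\<close>)
    next
      case c: 2
      show ?thesis
        by (rule up[of "swap_positions v c b" a c]) (use that pos ab c 3 in \<open>auto simp: sw\<close>)
    next
      case c: 3
      show ?thesis
        by (rule up[of "swap_positions v c b" a c]) (use that pos ab c 3 in \<open>auto simp: sw\<close>)
    qed
    ultimately show ?thesis by (auto simp: neighbour_def)
  qed
qed

section \<open>Counting neighbours over blocks of positions\<close>

definition neighbour_count :: "nat \<Rightarrow> (nat \<Rightarrow> nat) \<Rightarrow> (nat \<Rightarrow> nat) \<Rightarrow> (nat \<Rightarrow> nat) \<Rightarrow> nat set \<Rightarrow> nat set \<Rightarrow> nat"
  where "neighbour_count n h w v A B = (\<Sum>x\<in>A. \<Sum>y\<in>B. of_bool (neighbour n h w v x y))"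

lemma neighbour_count_commute:
  "neighbour_count n h w v A B = neighbour_count n h w v B A"
  unfolding neighbour_count_def by (subst sum.swap) (simp add: neighbour_commute)

text \<open>The sums run over ordered pairs, so the two mixed blocks agree by symmetry, and a
  neighbour inside one block is counted twice.\<close>

lemma neighbour_count_split:
  assumes "finite N" "I \<subseteq> N"
  shows "neighbour_count n h w v N N = neighbour_count n h w v I I +
    2 * neighbour_count n h w v (N - I) I + neighbour_count n h w v (N - I) (N - I)"
proof -
  have "finite I" "finite (N - I)" using assms by (auto intro: finite_subset)
  then have split: "sum f N = sum f I + sum f (N - I)" for f :: "nat \<Rightarrow> nat"
    using assms by (metis add.commute sum.subset_diff)
  have left: "neighbour_count n h w v N B =
      neighbour_count n h w v I B + neighbour_count n h w v (N - I) B" for B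
    unfolding neighbour_count_def by (rule split)
  have right: "neighbour_count n h w v A N =
      neighbour_count n h w v A I + neighbour_count n h w v A (N - I)" for A
    using left[of A] neighbour_count_commute[of n h w v A] by metis
  show ?thesis
    using left[of N] right[of I] right[of "N - I"] neighbour_count_commute[of n h w v I "N - I"]
    by linarith
qed

text \<open>Chains of these steps rearrange the entries at positions in \<open>I\<close> and leave
  all others in place.\<close>

definition up_swap :: "nat set \<Rightarrow> (nat \<Rightarrow> nat) \<Rightarrow> (nat \<Rightarrow> nat) \<Rightarrow> bool" where
  "up_swap I v v' \<longleftrightarrow> (\<exists>a\<in>I. \<exists>b\<in>I. a < b \<and> v a < v b \<and> v' = swap_positions v a b)"

lemma up_swapI:
  assumes "a \<in> I" "b \<in> I" "a < b" "v a < v b" "v' = swap_positions v a b"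
  shows "up_swap I v v'"
  using assms unfolding up_swap_def by blast

lemma up_swaps_swap:
  assumes "(up_swap I)\<^sup>*\<^sup>* w v" "a \<in> I" "b \<in> I" "a < b" "v a < v b"
  shows "(up_swap I)\<^sup>*\<^sup>* w (swap_positions v a b)"
  by (rule rtranclp_trans[OF assms(1)], rule r_into_rtranclp)
    (use assms in \<open>auto simp: up_swap_def\<close>)

lemma up_swaps_imp_rank_le:
  assumes "(up_swap I)\<^sup>*\<^sup>* w u" "0 \<notin> I"
  shows "w \<sqsubseteq> u"
  using assms(1)
proof induction
  case base
  show ?case by (rule rank_le_refl)
next
  case (step v v')
  then obtain a b where "a \<in> I" "a < b" "v a < v b" "v' = swap_positions v a b"
    unfolding up_swap_def by blast
  moreover from this assms(2) have "1 \<le> a" by (cases a) auto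
  ultimately show ?case by (intro rank_le_swap[OF step.IH])
qed

text \<open>Pairs avoiding \<open>a\<close> and \<open>b\<close> survive by
  \<open>neighbour_swap_disjoint\<close>. The pairs of \<open>c\<close> with \<open>a\<close> and
  with \<open>b\<close> may trade places, so only their sum is compared, by
  \<open>neighbour_swap_pair\<close>.\<close>

lemma neighbour_count_up_swap:
  assumes h: "hessenberg_function n h" and wv: "w \<sqsubseteq> v" and v: "v permutes {1..n}"
    and I: "I \<subseteq> {1..n}" and step: "up_swap I v v'"
  shows "w \<sqsubseteq> v'" "v' permutes {1..n}"
    "neighbour_count n h w v ({1..n} - I) I \<le> neighbour_count n h w v' ({1..n} - I) I"
    "neighbour_count n h w v ({1..n} - I) ({1..n} - I)
      \<le> neighbour_count n h w v' ({1..n} - I) ({1..n} - I)"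
proof -
  obtain a b where ab: "a \<in> I" "b \<in> I" "a < b" "v a < v b" and v': "v' = swap_positions v a b"
    using step unfolding up_swap_def by blast
  have in_n: "a \<in> {1..n}" "b \<in> {1..n}" using ab I by auto
  have fin: "finite I" using I finite_subset by blast
  show "w \<sqsubseteq> v'" using in_n by (intro rank_le_swap[OF wv _ ab(3,4) v']) auto
  show "v' permutes {1..n}" unfolding v' by (rule swap_positions_permutes[OF v in_n])
  have disjoint: "of_bool (neighbour n h w v c d) \<le> (of_bool (neighbour n h w v' c d) :: nat)"
    if "c \<notin> {a, b}" "d \<notin> {a, b}" for c d
    using neighbour_swap_disjoint[of n h w v c d a b] that ab in_n unfolding v' by auto
  show "neighbour_count n h w v ({1..n} - I) ({1..n} - I)
      \<le> neighbour_count n h w v' ({1..n} - I) ({1..n} - I)"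
    unfolding neighbour_count_def using ab by (intro sum_mono disjoint) auto
  show "neighbour_count n h w v ({1..n} - I) I \<le> neighbour_count n h w v' ({1..n} - I) I"
    unfolding neighbour_count_def
  proof (rule sum_mono)
    fix c assume c: "c \<in> {1..n} - I"
    have split: "sum f I = f a + f b + sum f (I - {a, b})" for f :: "nat \<Rightarrow> nat"
    proof -
      have "sum f I = sum f (I - {a, b}) + sum f {a, b}"
        using ab fin by (intro sum.subset_diff) auto
      then show ?thesis using ab by simp
    qed
    have "of_bool (neighbour n h w v c a) + of_bool (neighbour n h w v c b)
        \<le> (of_bool (neighbour n h w v' c a) + of_bool (neighbour n h w v' c b) :: nat)"
      unfolding v' using c ab
      by (intro neighbour_swap_pair[OF h wv permutes_inj[OF v] in_n]) auto
    moreover have "(\<Sum>d\<in>I - {a, b}. of_bool (neighbour n h w v c d))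
        \<le> (\<Sum>d\<in>I - {a, b}. of_bool (neighbour n h w v' c d) :: nat)"
      using c ab by (intro sum_mono disjoint) auto
    ultimately show "(\<Sum>y\<in>I. of_bool (neighbour n h w v c y))
        \<le> (\<Sum>y\<in>I. of_bool (neighbour n h w v' c y) :: nat)"
      unfolding split[of "\<lambda>y. of_bool (neighbour n h w v c y)"]
        split[of "\<lambda>y. of_bool (neighbour n h w v' c y)"] by linarith
  qed
qed

lemma neighbour_count_up_swaps:
  assumes "hessenberg_function n h" "w permutes {1..n}" "I \<subseteq> {1..n}" "(up_swap I)\<^sup>*\<^sup>* w u"
  shows "w \<sqsubseteq> u \<and> u permutes {1..n} \<and>
    neighbour_count n h w w ({1..n} - I) I \<le> neighbour_count n h w u ({1..n} - I) I \<and>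
    neighbour_count n h w w ({1..n} - I) ({1..n} - I)
      \<le> neighbour_count n h w u ({1..n} - I) ({1..n} - I)"
  using assms(4)
proof induction
  case base
  show ?case using assms(2) by (simp add: rank_le_refl)
next
  case (step v v')
  then have "w \<sqsubseteq> v" "v permutes {1..n}" by auto
  from neighbour_count_up_swap[OF assms(1) this assms(3) step(2)] step.IH show ?case
    by linarith
qed

text \<open>Arcs out of \<open>v\<close> correspond to pairs \<open>x < y\<close>, and each pair is
  counted together with its mirror image.\<close>

lemma neighbour_count_eq_out_degree:
  assumes w: "w permutes {1..n}" and v: "v permutes {1..n}" "w \<sqsubseteq> v"
  shows "neighbour_count n h w v {1..n} {1..n} =
    2 * out_degree (hessenberg_schubert_graph n w h) v"
proof -
  let ?G = "hessenberg_schubert_graph n w h"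
  let ?E = "{(x, y). x < y \<and> neighbour n h w v x y}"
  have fin: "finite ?E"
    by (rule finite_subset[of _ "{1..n} \<times> {1..n}"]) (auto simp: neighbour_def hess_pair_def)
  have "out_arcs ?G v = (\<lambda>(x, y). (v, swap_positions v x y)) ` ?E" (is "?L = ?f ` ?E")
  proof (intro equalityI subsetI)
    fix e assume "e \<in> ?L"
    then obtain x y where "e = (v, swap_positions v x y)" "1 \<le> x" "x < y" "y \<le> n" "y \<le> h x"
      "w \<sqsubseteq> swap_positions v x y"
      by (auto simp: out_arcs_def hessenberg_schubert_graph_def bruhat_interval_longest[OF w]
          induce_subgraph_def hessenberg_graph_def)
    then have "e = ?f (x, y)" "(x, y) \<in> ?E" by (auto simp: neighbour_def hess_pair_def)
    then show "e \<in> ?f ` ?E" by (rule image_eqI)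
  next
    fix e assume "e \<in> ?f ` ?E"
    then obtain x y where e: "e = (v, swap_positions v x y)"
      and xy: "1 \<le> x" "x < y" "y \<le> n" "y \<le> h x" "w \<sqsubseteq> swap_positions v x y"
      by (auto simp: neighbour_def hess_pair_def)
    have "swap_positions v x y permutes {1..n}"
      using v xy by (intro swap_positions_permutes) auto
    with e xy v show "e \<in> ?L"
      by (auto simp: out_arcs_def hessenberg_schubert_graph_def bruhat_interval_longest[OF w]
          induce_subgraph_def hessenberg_graph_def)
  qed
  moreover have "inj_on ?f ?E"
    using swap_positions_inject[OF permutes_inj[OF v(1)]] by (auto simp: inj_on_def)
  ultimately have deg: "out_degree ?G v = card ?E"
    by (simp add: out_degree_def card_image)
  let ?S = "{(x, y). neighbour n h w v x y}"
  have S: "?S = ?E \<union> prod.swap ` ?E"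
  proof (intro equalityI subsetI)
    fix p assume "p \<in> ?S"
    then obtain x y where p: "p = (x, y)" "neighbour n h w v x y" by auto
    then have "x < y \<or> y < x" by (auto simp: neighbour_def hess_pair_def)
    then show "p \<in> ?E \<union> prod.swap ` ?E"
      using p neighbour_commute[of n h w v x y] by (auto simp: image_iff)
  qed (auto simp: neighbour_commute)
  have "neighbour_count n h w v {1..n} {1..n} =
      (\<Sum>(x, y)\<in>{1..n} \<times> {1..n}. of_bool (neighbour n h w v x y))"
    unfolding neighbour_count_def by (rule sum.cartesian_product)
  also have "\<dots> = (\<Sum>p\<in>{1..n} \<times> {1..n}. of_bool (p \<in> ?S))"
    by (intro sum.cong) auto
  also have "\<dots> = card (({1..n} \<times> {1..n}) \<inter> ?S)"
    by (simp del: mem_Collect_eq)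
  also have "({1..n} \<times> {1..n}) \<inter> ?S = ?S"
    by (auto simp: neighbour_def hess_pair_def)
  also have "card ?S = card ?E + card (prod.swap ` ?E)"
    unfolding S using fin by (intro card_Un_disjoint) auto
  also have "card (prod.swap ` ?E) = card ?E"
    by (intro card_image) simp
  finally show ?thesis by (simp add: deg)
qed

text \<open>Of the three blocks in \<open>neighbour_count_split\<close>, the one inside
  \<open>I\<close> grows strictly and the others do not shrink, so \<open>u\<close> has larger
  degree than \<open>w\<close>.\<close>

lemma not_regular_if_neighbour_count_less:
  assumes "hessenberg_function n h" "w permutes {1..n}" "I \<subseteq> {1..n}" "(up_swap I)\<^sup>*\<^sup>* w u"
    and less: "neighbour_count n h w w I I < neighbour_count n h w u I I"
  shows "\<not> regular_graph (hessenberg_schubert_graph n w h)"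
proof
  assume "regular_graph (hessenberg_schubert_graph n w h)"
  then obtain d where d: "\<And>v. v permutes {1..n} \<Longrightarrow> w \<sqsubseteq> v \<Longrightarrow>
      out_degree (hessenberg_schubert_graph n w h) v = d"
    unfolding regular_graph_def
    by (auto simp: hessenberg_schubert_graph_def bruhat_interval_longest[OF assms(2)])
  note u = neighbour_count_up_swaps[OF assms(1-4)]
  have "neighbour_count n h w v {1..n} {1..n} = 2 * d" if "v permutes {1..n}" "w \<sqsubseteq> v" for v
    using neighbour_count_eq_out_degree[OF assms(2) that] d[OF that] by simp
  from this[OF assms(2) rank_le_refl] this[of u] u less show False
    using neighbour_count_split[OF _ assms(3), of n h w w]
      neighbour_count_split[OF _ assms(3), of n h w u] by simp
qed

lemma neighbour_count_three:
  assumes "a < b" "b < c"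
  shows "neighbour_count n h w v {a, b, c} {a, b, c} =
    2 * (of_bool (neighbour n h w v a b) + of_bool (neighbour n h w v a c) +
      of_bool (neighbour n h w v b c))"
  using assms neighbour_commute[of n h w v b a] neighbour_commute[of n h w v c a]
    neighbour_commute[of n h w v c b]
  by (simp add: neighbour_count_def neighbour_irrefl del: sum_of_bool_eq)

lemma neighbour_count_four:
  assumes "a < b" "b < c" "c < d"
  shows "neighbour_count n h w v {a, b, c, d} {a, b, c, d} =
    2 * (of_bool (neighbour n h w v a b) + of_bool (neighbour n h w v a c) +
      of_bool (neighbour n h w v a d) + of_bool (neighbour n h w v b c) +
      of_bool (neighbour n h w v b d) + of_bool (neighbour n h w v c d))"
  using assms neighbour_commute[of n h w v b a] neighbour_commute[of n h w v c a]
    neighbour_commute[of n h w v c b] neighbour_commute[of n h w v d a]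
    neighbour_commute[of n h w v d b] neighbour_commute[of n h w v d c]
  by (simp add: neighbour_count_def neighbour_irrefl del: sum_of_bool_eq)

section \<open>Patterns\<close>

text \<open>At \<open>w\<close> only \<open>a, b\<close> can give a neighbour: \<open>b, c\<close>
  is an inversion and \<open>a, c\<close> is not allowed. At \<open>?u\<close> the swap of
  \<open>a, b\<close> leads back to \<open>w\<close>, and the allowed pair \<open>b, c\<close> is
  now an ascent.\<close>

lemma not_regular_if_132:
  assumes h: "hessenberg_function n h" and w: "w permutes {1..n}"
    and pos: "1 \<le> a" "a < b" "b < c" "c \<le> n" "h a < c" "c \<le> h b"
    and val: "w a < w c" "w c < w b"
  shows "\<not> regular_graph (hessenberg_schubert_graph n w h)"
proof (rule not_regular_if_neighbour_count_less[OF h w, of "{a, b, c}"])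
  let ?u = "swap_positions w a b"
  show "{a, b, c} \<subseteq> {1..n}" using pos by auto
  show "(up_swap {a, b, c})\<^sup>*\<^sup>* w ?u"
    using pos val by (intro r_into_rtranclp up_swapI[of a _ b]) auto
  have wu: "w \<sqsubseteq> ?u"
    using pos val by (intro rank_le_swap[OF rank_le_refl, of a b]) auto
  have "neighbour n h w ?u b c"
    using pos val rank_le_swap[OF wu, of b c]
    by (auto simp: neighbour_def hess_pair_def swap_positions_apply)
  moreover have "neighbour n h w ?u a b" if "neighbour n h w w a b"
    using that rank_le_refl[of w] by (simp add: neighbour_def swap_positions_twice)
  moreover have "\<not> neighbour n h w w b c" "\<not> neighbour n h w w a c"
    using pos val by (auto simp: neighbour_self hess_pair_def)
  ultimately show "neighbour_count n h w w {a, b, c} {a, b, c}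
      < neighbour_count n h w ?u {a, b, c} {a, b, c}"
    using pos by (simp add: neighbour_count_three)
qed

text \<open>The mirror situation: at \<open>w\<close> only \<open>b, c\<close> can give a neighbour.
  At \<open>?u\<close> its swap leads back to \<open>w\<close>, and the allowed pair
  \<open>a, b\<close> has become an ascent.\<close>

lemma not_regular_if_213:
  assumes h: "hessenberg_function n h" and w: "w permutes {1..n}"
    and pos: "1 \<le> a" "a < b" "b < c" "c \<le> n" "b \<le> h a" "h a < c"
    and val: "w b < w a" "w a < w c"
  shows "\<not> regular_graph (hessenberg_schubert_graph n w h)"
proof (rule not_regular_if_neighbour_count_less[OF h w, of "{a, b, c}"])
  let ?u = "swap_positions w b c"
  show "{a, b, c} \<subseteq> {1..n}" using pos by auto
  show "(up_swap {a, b, c})\<^sup>*\<^sup>* w ?u"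
    using pos val by (intro r_into_rtranclp up_swapI[of b _ c]) auto
  have wu: "w \<sqsubseteq> ?u"
    using pos val by (intro rank_le_swap[OF rank_le_refl, of b c]) auto
  have "neighbour n h w ?u a b"
    using pos val rank_le_swap[OF wu, of a b]
    by (auto simp: neighbour_def hess_pair_def swap_positions_apply)
  moreover have "neighbour n h w ?u b c" if "neighbour n h w w b c"
    using that rank_le_refl[of w] by (simp add: neighbour_def swap_positions_twice)
  moreover have "\<not> neighbour n h w w a b" "\<not> neighbour n h w w a c"
    using pos val by (auto simp: neighbour_self hess_pair_def)
  ultimately show "neighbour_count n h w w {a, b, c} {a, b, c}
      < neighbour_count n h w ?u {a, b, c} {a, b, c}"
    using pos by (simp add: neighbour_count_three)
qed

section \<open>Patterns on four positions, with chains of swaps written as rewritings of four-letter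
  words\<close>

definition place :: "(nat \<Rightarrow> nat) \<Rightarrow> nat \<Rightarrow> nat \<Rightarrow> nat \<Rightarrow> nat \<Rightarrow> nat \<Rightarrow> nat \<Rightarrow> nat \<Rightarrow> nat \<Rightarrow> nat \<Rightarrow> nat" where
  "place w i j k l p q r s = w(i := p, j := q, k := r, l := s)"

lemma place_self: "place w i j k l (w i) (w j) (w k) (w l) = w"
  by (auto simp: place_def)

lemma place_apply:
  assumes "i < j" "j < k" "k < l"
  shows "place w i j k l p q r s i = p" "place w i j k l p q r s j = q"
    "place w i j k l p q r s k = r" "place w i j k l p q r s l = s"
  using assms by (auto simp: place_def)

lemma swap_positions_place:
  assumes "i < j" "j < k" "k < l"
  shows "swap_positions (place w i j k l p q r s) i j = place w i j k l q p r s"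
    "swap_positions (place w i j k l p q r s) i k = place w i j k l r q p s"
    "swap_positions (place w i j k l p q r s) i l = place w i j k l s q r p"
    "swap_positions (place w i j k l p q r s) j k = place w i j k l p r q s"
    "swap_positions (place w i j k l p q r s) j l = place w i j k l p s r q"
    "swap_positions (place w i j k l p q r s) k l = place w i j k l p q s r"
  using assms by (auto simp: place_def fun_eq_iff swap_positions_apply)

text \<open>The six rules follow the order \<open>ij\<close>, \<open>ik\<close>, \<open>il\<close>,
  \<open>jk\<close>, \<open>jl\<close>, \<open>kl\<close> of the swapped positions; later uses cite
  them by this numbering.\<close>

lemma up_swaps_place:
  assumes pos: "i < j" "j < k" "k < l"
    and z: "(up_swap {i, j, k, l})\<^sup>*\<^sup>* w (place w i j k l p q r s)"
  shows "p < q \<Longrightarrow> (up_swap {i, j, k, l})\<^sup>*\<^sup>* w (place w i j k l q p r s)"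
    "p < r \<Longrightarrow> (up_swap {i, j, k, l})\<^sup>*\<^sup>* w (place w i j k l r q p s)"
    "p < s \<Longrightarrow> (up_swap {i, j, k, l})\<^sup>*\<^sup>* w (place w i j k l s q r p)"
    "q < r \<Longrightarrow> (up_swap {i, j, k, l})\<^sup>*\<^sup>* w (place w i j k l p r q s)"
    "q < s \<Longrightarrow> (up_swap {i, j, k, l})\<^sup>*\<^sup>* w (place w i j k l p s r q)"
    "r < s \<Longrightarrow> (up_swap {i, j, k, l})\<^sup>*\<^sup>* w (place w i j k l p q s r)"
proof -
  note step = up_swaps_swap[OF z]
  note eqs = swap_positions_place[OF pos] place_apply[OF pos]
  show "p < q \<Longrightarrow> (up_swap {i, j, k, l})\<^sup>*\<^sup>* w (place w i j k l q p r s)"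
    by (rule step[of i j, unfolded eqs]) (use pos in simp_all)
  show "p < r \<Longrightarrow> (up_swap {i, j, k, l})\<^sup>*\<^sup>* w (place w i j k l r q p s)"
    by (rule step[of i k, unfolded eqs]) (use pos in simp_all)
  show "p < s \<Longrightarrow> (up_swap {i, j, k, l})\<^sup>*\<^sup>* w (place w i j k l s q r p)"
    by (rule step[of i l, unfolded eqs]) (use pos in simp_all)
  show "q < r \<Longrightarrow> (up_swap {i, j, k, l})\<^sup>*\<^sup>* w (place w i j k l p r q s)"
    by (rule step[of j k, unfolded eqs]) (use pos in simp_all)
  show "q < s \<Longrightarrow> (up_swap {i, j, k, l})\<^sup>*\<^sup>* w (place w i j k l p s r q)"
    by (rule step[of j l, unfolded eqs]) (use pos in simp_all)
  show "r < s \<Longrightarrow> (up_swap {i, j, k, l})\<^sup>*\<^sup>* w (place w i j k l p q s r)"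
    by (rule step[of k l, unfolded eqs]) (use pos in simp_all)
qed

text \<open>With the entries named in increasing order, \<open>w\<close> reads acbd and the new
  permutation cdab. All pairs except possibly \<open>i, l\<close> are allowed, and every swap of
  cdab stays above \<open>w\<close>. At \<open>w\<close> the inversion \<open>j, k\<close> is lost,
  while \<open>i, l\<close> contributes equally to both.\<close>

lemma not_regular_if_1324:
  assumes h: "hessenberg_function n h" and w: "w permutes {1..n}"
    and pos: "1 \<le> i" "i < j" "j < k" "k < l" "l \<le> n"
    and edge: "l \<le> h j" "k \<le> h i"
    and val: "w i < w k" "w k < w j" "w j < w l"
  shows "\<not> regular_graph (hessenberg_schubert_graph n w h)"
proof -
  let ?I = "{i, j, k, l}"
  define a b c d where "a = w i" "b = w k" "c = w j" "d = w l"
  note less = val[folded a_b_c_d_def]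
  let ?R = "\<lambda>p q r s. (up_swap ?I)\<^sup>*\<^sup>* w (place w i j k l p q r s)"
  note up = up_swaps_place[OF pos(2-4)]
  have R0: "?R a c b d" unfolding a_b_c_d_def place_self by simp
  have R1: "?R c a b d" using up(1)[OF R0] less by simp
  have R2: "?R c a d b" using up(6)[OF R1] less by simp
  have R3: "?R c d a b" using up(4)[OF R2] less by simp
  \<comment> \<open>The remaining neighbours of cdab, labelled by the swapped positions; swapping
    \<open>j, k\<close> gives \<open>R2\<close>.\<close>
  have ij: "?R d c a b" using up(1)[OF R3] less by simp
  have kl: "?R c d b a" using up(6)[OF R3] less by simp
  have jl: "?R c b a d" using up(4)[OF R1] less by simp
  have "?R a c d b" using up(6)[OF R0] less by simp
  from up(4)[OF this] have ik: "?R a d c b" using less by simp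
  have "?R a d b c" using up(5)[OF R0] less by simp
  from up(2)[OF this] have il: "?R b d a c" using less by simp
  have hess: "hess_pair n h i j" "hess_pair n h i k" "hess_pair n h j k" "hess_pair n h j l"
    "hess_pair n h k l"
  proof -
    show ik: "hess_pair n h i k" and jl: "hess_pair n h j l"
      using pos edge by (auto simp: hess_pair_def)
    show "hess_pair n h i j" "hess_pair n h j k" using hess_pair_mono[OF h ik] pos by auto
    show "hess_pair n h k l" using hess_pair_mono[OF h jl] pos by auto
  qed
  have self: "neighbour n h w w j k \<longleftrightarrow> False" "neighbour n h w w i l \<longleftrightarrow> hess_pair n h i l"
    using pos val by (auto simp: neighbour_self)
  show ?thesis
  proof (rule not_regular_if_neighbour_count_less[OF h w _ R3])
    show "?I \<subseteq> {1..n}" using pos by auto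
    have le: "w \<sqsubseteq> place w i j k l p q r s" if "?R p q r s" for p q r s
      using up_swaps_imp_rank_le[OF that] pos by auto
    show "neighbour_count n h w w ?I ?I < neighbour_count n h w (place w i j k l c d a b) ?I ?I"
      unfolding neighbour_count_four[OF pos(2-4)] self
      unfolding neighbour_def swap_positions_place[OF pos(2-4)]
      using hess le[OF ij] le[OF ik] le[OF il] le[OF R2] le[OF jl] le[OF kl]
      by (simp add: of_bool_def)
  qed
qed

text \<open>All six pairs are allowed. On badc the pairs \<open>i, j\<close> and \<open>k, l\<close>
  are inversions, which leaves at most four neighbours; on dbca every swap except possibly that of
  \<open>i, l\<close> stays above \<open>w\<close>, which gives at least five.\<close>

lemma not_regular_if_2143:
  assumes h: "hessenberg_function n h" and w: "w permutes {1..n}"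
    and pos: "1 \<le> i" "i < j" "j < k" "k < l" "l \<le> n"
    and edge: "l \<le> h i"
    and val: "w j < w i" "w i < w l" "w l < w k"
  shows "\<not> regular_graph (hessenberg_schubert_graph n w h)"
proof -
  let ?I = "{i, j, k, l}"
  define a b c d where "a = w j" "b = w i" "c = w l" "d = w k"
  note less = val[folded a_b_c_d_def]
  let ?R = "\<lambda>p q r s. (up_swap ?I)\<^sup>*\<^sup>* w (place w i j k l p q r s)"
  note up = up_swaps_place[OF pos(2-4)]
  have R0: "?R b a d c" unfolding a_b_c_d_def place_self by simp
  have R1: "?R b d a c" using up(4)[OF R0] less by simp
  have R2: "?R d b a c" using up(1)[OF R1] less by simp
  have R3: "?R d b c a" using up(6)[OF R2] less by simp
  have jk: "?R d c b a" using up(4)[OF R3] less by simp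
  have ij: "?R b d c a" using up(6)[OF R1] less by simp
  have "?R c a d b" using up(3)[OF R0] less by simp
  from up(5)[OF this] have ik: "?R c b d a" using less by simp
  have "?R d a b c" using up(2)[OF R0] less by simp
  from up(6)[OF this] have jl: "?R d a c b" using less by simp
  have il: "hess_pair n h i l" using pos edge by (auto simp: hess_pair_def)
  have hess: "hess_pair n h i j" "hess_pair n h i k" "hess_pair n h j k" "hess_pair n h j l"
    "hess_pair n h k l"
    using hess_pair_mono[OF h il] pos by auto
  have self: "neighbour n h w w i j \<longleftrightarrow> False" "neighbour n h w w k l \<longleftrightarrow> False"
    using pos val by (auto simp: neighbour_self)
  show ?thesis
  proof (rule not_regular_if_neighbour_count_less[OF h w _ R3])
    show "?I \<subseteq> {1..n}" using pos by auto
    have le: "w \<sqsubseteq> place w i j k l p q r s" if "?R p q r s" for p q r s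
      using up_swaps_imp_rank_le[OF that] pos by auto
    show "neighbour_count n h w w ?I ?I < neighbour_count n h w (place w i j k l d b c a) ?I ?I"
      unfolding neighbour_count_four[OF pos(2-4)] self
      unfolding neighbour_def swap_positions_place[OF pos(2-4)]
      using hess le[OF ij] le[OF ik] le[OF R2] le[OF jl] le[OF jk]
      by (simp add: of_bool_def)
  qed
qed

text \<open>Only \<open>i, j\<close>, \<open>j, k\<close> and \<open>k, l\<close> are allowed. On
  bdac the middle pair is an inversion, which leaves at most two neighbours; on dbca all three swaps
  stay above \<open>w\<close>.\<close>

lemma not_regular_if_2413:
  assumes h: "hessenberg_function n h" and w: "w permutes {1..n}"
    and pos: "1 \<le> i" "i < j" "j < k" "k < l" "l \<le> n"
    and edge: "j \<le> h i" "h i < k" "k \<le> h j" "h j < l" "l \<le> h k"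
    and val: "w k < w i" "w i < w l" "w l < w j"
  shows "\<not> regular_graph (hessenberg_schubert_graph n w h)"
proof -
  let ?I = "{i, j, k, l}"
  define a b c d where "a = w k" "b = w i" "c = w l" "d = w j"
  note less = val[folded a_b_c_d_def]
  let ?R = "\<lambda>p q r s. (up_swap ?I)\<^sup>*\<^sup>* w (place w i j k l p q r s)"
  note up = up_swaps_place[OF pos(2-4)]
  have R0: "?R b d a c" unfolding a_b_c_d_def place_self by simp
  have R1: "?R d b a c" using up(1)[OF R0] less by simp
  have R2: "?R d b c a" using up(6)[OF R1] less by simp
  have ij: "?R b d c a" using up(6)[OF R0] less by simp
  have jk: "?R d c b a" using up(4)[OF R2] less by simp
  have hess: "hess_pair n h i j" "hess_pair n h j k" "hess_pair n h k l" "\<not> hess_pair n h i k"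
    "\<not> hess_pair n h j l" "\<not> hess_pair n h i l"
    using pos edge by (auto simp: hess_pair_def)
  have self: "neighbour n h w w j k \<longleftrightarrow> False"
    using pos val by (auto simp: neighbour_self)
  show ?thesis
  proof (rule not_regular_if_neighbour_count_less[OF h w _ R2])
    show "?I \<subseteq> {1..n}" using pos by auto
    have le: "w \<sqsubseteq> place w i j k l p q r s" if "?R p q r s" for p q r s
      using up_swaps_imp_rank_le[OF that] pos by auto
    show "neighbour_count n h w w ?I ?I < neighbour_count n h w (place w i j k l d b c a) ?I ?I"
      unfolding neighbour_count_four[OF pos(2-4)] self
      unfolding neighbour_def swap_positions_place[OF pos(2-4)]
      using hess le[OF ij] le[OF R1] le[OF jk]
      by (simp add: of_bool_def)
  qed
qed

theorem theorem3p11: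
  fixes n :: nat and h w :: "nat \<Rightarrow> nat"
  assumes "hessenberg_function n h"
    and "w permutes {1..n}"
    and "hessenberg_generator n h w"
    and "contains_2143 n h w \<or> contains_1324 n h w \<or> contains_1243 n h w \<or>
         contains_2134 n h w \<or> contains_1423 n h w \<or> contains_2314 n h w \<or>
         contains_2413 n h w"
  shows "\<not> regular_graph (hessenberg_schubert_graph n w h)"
proof -
  note hw = assms(1,2)
  have mono: "h x \<le> h y" if "1 \<le> x" "x \<le> y" "y \<le> n" for x y
    using assms(1) that unfolding hessenberg_function_def
    by (auto intro: mono_onD[of "{1..n}" h])
  from assms(4) consider "contains_2143 n h w" | "contains_1324 n h w" | "contains_1243 n h w"
    | "contains_2134 n h w" | "contains_1423 n h w" | "contains_2314 n h w" | "contains_2413 n h w"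
    by blast
  then show ?thesis
  proof cases
    case 1
    then show ?thesis unfolding contains_2143_def using not_regular_if_2143[OF hw] by blast
  next
    case 2
    then show ?thesis unfolding contains_1324_def using not_regular_if_1324[OF hw] by blast
  next
    case 3
    then obtain i j k l where "1 \<le> i" "i < j" "j < k" "k < l" "l \<le> n" "l \<le> h j" "h i < l"
      "w i < w j" "w j < w l" "w l < w k"
      unfolding contains_1243_def by blast
    \<comment> \<open>The positions \<open>i, k, l\<close> carry 132, and
      \<open>l \<le> h j \<le> h k\<close>.\<close>
    then show ?thesis
      using mono[of j k] by (intro not_regular_if_132[OF hw, of i k l]) auto
  next
    case 4
    then obtain i j k l where "1 \<le> i" "i < j" "j < k" "k < l" "l \<le> n" "k \<le> h i" "h i < l"
      "w j < w i" "w i < w k" "w k < w l"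
      unfolding contains_2134_def by blast
    \<comment> \<open>The positions \<open>i, j, l\<close> carry 213, and
      \<open>j < k \<le> h i\<close>.\<close>
    then show ?thesis by (intro not_regular_if_213[OF hw, of i j l]) auto
  next
    case 5
    then obtain i j k l where "1 \<le> i" "i < j" "j < k" "k < l" "l \<le> n" "l \<le> h j" "h i < l"
      "w i < w k" "w k < w l" "w l < w j"
      unfolding contains_1423_def by blast
    then show ?thesis by (intro not_regular_if_132[OF hw, of i j l]) auto
  next
    case 6
    then obtain i j k l where "1 \<le> i" "i < j" "j < k" "k < l" "l \<le> n" "k \<le> h i" "h i < l"
      "w k < w i" "w i < w j" "w j < w l"
      unfolding contains_2314_def by blast
    then show ?thesis by (intro not_regular_if_213[OF hw, of i k l]) auto
  next
    case 7
    then obtain i j k l where "1 \<le> i" "i < j" "j < k" "k < l" "l \<le> n" "j \<le> h i" "h i < k"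
      "k \<le> h j" "h j < l" "l \<le> h k" "w k < w i" "w i < w l" "w l < w j"
      unfolding contains_2413_def by (meson le_less_trans)
    then show ?thesis by (rule not_regular_if_2413[OF hw])
  qed
qed

end
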